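(* Let $G=(V,E)$ be an arbitrary finite network in which every node has at least one neighbor, with a clustered structure $V=V_1\cup\dots\cup V_K$, where $V_i\cap V_j=\emptyset$ for $i\ne j$. Let $\sigma\in(0,1)$, and let $(B_v(t))_{v\in V}$, $t\ge 0$, be a solution of the Type I dynamics with threshold $\sigma$ on $G$, i.e. of $$\frac{d}{dt}B_v(t)=f\Big(\frac{1}{\deg(v)}\sum_{u\in N_v}B_u(t)\Big)-B_v(t),\quad v\in V,\qquad f(x)=\begin{cases}1&x>\sigma\\ 0&x<\sigma\\ 1/2&x=\sigma,\end{cases}$$ with values $B_v(t)\in[0,1]$. Suppose that for each $k\in\{1,\dots,K\}$ there is $\alpha_k\in[0,1]$ with $B_v(0)=\alpha_k$ for every $v\in V_k$, and let $$\beta_k=\inf_{v\in V_k}\frac{|N_v\cap V_k|}{\deg(v)}$$ be the minimum node expansion of $V_k$. Then for each $k$: if $\alpha_k\beta_k>\sigma$, all nodes in $V_k$ become blue, i.e. $\lim_{t\to\infty}B_v(t)=1$ for all $v\in V_k$; if $(1-\alpha_k)\beta_k>1-\sigma$, all nodes in $V_k$ become red, i.e. $\lim_{t\to\infty}B_v(t)=0$ for all $v\in V_k$.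
   Context: $G=(V,E)$ is a finite graph (undirected or directed) without self-loops, $N_v=\{u\in V:(u,v)\in E\}$ is the set of (in-)neighbors of $v$, and $\deg(v)=|N_v|$. $B_v(t)\in[0,1]$ represents the probability that node $v$ is secure ("blue") at time $t$; $1-B_v(t)$ is the probability that it is compromised ("red"). The clusters $V_1,\dots,V_K$ are nonempty. A solution is a family of absolutely continuous functions $B_v:[0,\infty)\to[0,1]$ satisfying the differential equation for almost every $t\ge0$. *)

theory Defs
  imports "HOL-Analysis.Analysis" "Graph_Theory.Pair_Digraph"
begin

text \<open>
  A finite directed loop-free graph is a \<^locale>\<open>pair_digraph\<close>, whose arcs form a set of ordered
  pairs of vertices. An undirected graph is the special case of a symmetric arc set.
\<close>

definition nbrs :: "'a pair_pre_digraph \<Rightarrow> 'a \<Rightarrow> 'a set"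
  where "nbrs G v = {u \<in> pverts G. (u, v) \<in> parcs G}"

definition deg :: "'a pair_pre_digraph \<Rightarrow> 'a \<Rightarrow> nat"
  where "deg G v = card (nbrs G v)"

definition min_node_expansion :: "'a pair_pre_digraph \<Rightarrow> 'a set \<Rightarrow> real"
  where "min_node_expansion G C = (INF v\<in>C. real (card (nbrs G v \<inter> C)) / real (deg G v))"

definition threshold_fun :: "real \<Rightarrow> real \<Rightarrow> real"
  where "threshold_fun \<sigma> x = (if x > \<sigma> then 1 else if x < \<sigma> then 0 else 1 / 2)"

text \<open>
  The usual epsilon-delta notion of an absolutely continuous function, on a real interval \<open>S\<close>.
  The constant \<^const>\<open>absolutely_continuous\<close> of the library is about measures. The set \<open>\<D>\<close> ranges
  over the finite families of non-overlapping compact intervals \<open>[Inf I, Sup I]\<close> contained in \<open>S\<close>.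
\<close>

definition absolutely_continuous_fun_on :: "real set \<Rightarrow> (real \<Rightarrow> real) \<Rightarrow> bool"
  where "absolutely_continuous_fun_on S f \<longleftrightarrow>
    (\<forall>\<epsilon>>0. \<exists>\<delta>>0. \<forall>\<D>. \<D> division_of \<Union>\<D> \<and> \<Union>\<D> \<subseteq> S \<and> (\<Sum>I\<in>\<D>. Sup I - Inf I) < \<delta> \<longrightarrow>
       (\<Sum>I\<in>\<D>. \<bar>f (Sup I) - f (Inf I)\<bar>) < \<epsilon>)"

text \<open>
  Absolute continuity on \<open>[0,\<infinity>)\<close> is required on compact subintervals, as usual for solutions of
  differential equations in the sense of Caratheodory. Only the values \<open>B v t\<close> with \<open>v\<close> a vertex
  and \<open>t \<ge> 0\<close> matter.
\<close>

definition type1_solution ::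
  "'a pair_pre_digraph \<Rightarrow> real \<Rightarrow> ('a \<Rightarrow> real \<Rightarrow> real) \<Rightarrow> bool"
  where "type1_solution G \<sigma> B \<longleftrightarrow>
    (\<forall>v\<in>pverts G.
       (\<forall>t\<ge>0. B v t \<in> {0..1}) \<and>
       (\<forall>T\<ge>0. absolutely_continuous_fun_on {0..T} (B v)) \<and>
       (AE t in lebesgue_on {0..}.
          (B v has_real_derivative
             threshold_fun \<sigma> ((1 / real (deg G v)) * (\<Sum>u\<in>nbrs G v. B u t)) - B v t)
          (at t within {0..})))"

end

theory Submission
  imports Defs
begin

section \<open>Absolutely continuous functions on an interval\<close>

lemma absolutely_continuous_fun_onE:
  assumes "absolutely_continuous_fun_on S f" "\<epsilon> > 0"
  obtains \<delta> where "\<delta> > 0"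
    "\<And>\<D>. \<lbrakk>\<D> division_of \<Union>\<D>; \<Union>\<D> \<subseteq> S; (\<Sum>I\<in>\<D>. Sup I - Inf I) < \<delta>\<rbrakk>
      \<Longrightarrow> (\<Sum>I\<in>\<D>. \<bar>f (Sup I) - f (Inf I)\<bar>) < \<epsilon>"
  using assms unfolding absolutely_continuous_fun_on_def by metis

lemma absolutely_continuous_fun_on_diff_const:
  assumes "absolutely_continuous_fun_on S f"
  shows "absolutely_continuous_fun_on S (\<lambda>x. c - f x)"
  using assms unfolding absolutely_continuous_fun_on_def by (simp add: abs_minus_commute)

lemma absolutely_continuous_fun_on_imp_continuous_on:
  assumes "absolutely_continuous_fun_on {a..b} f"
  shows "continuous_on {a..b} f"
  unfolding continuous_on_iff
proof (intro ballI allI impI)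
  fix x and e :: real
  assume x: "x \<in> {a..b}" and "0 < e"
  with assms obtain d where d: "d > 0" and close:
    "\<And>\<D>. \<lbrakk>\<D> division_of \<Union>\<D>; \<Union>\<D> \<subseteq> {a..b}; (\<Sum>I\<in>\<D>. Sup I - Inf I) < d\<rbrakk>
      \<Longrightarrow> (\<Sum>I\<in>\<D>. \<bar>f (Sup I) - f (Inf I)\<bar>) < e"
    using absolutely_continuous_fun_onE by blast
  have *: "\<bar>f v - f u\<bar> < e" if "u \<in> {a..b}" "v \<in> {a..b}" "u \<le> v" "v - u < d" for u v
    using close[of "{{u..v}}"] that division_of_self[of u v] by auto
  show "\<exists>d>0. \<forall>y\<in>{a..b}. dist y x < d \<longrightarrow> dist (f y) (f x) < e"
  proof (intro exI conjI ballI impI)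
    fix y assume y: "y \<in> {a..b}" "dist y x < d"
    then show "dist (f y) (f x) < e"
      using *[of x y] *[of y x] x by (cases "x \<le> y") (auto simp: dist_real_def)
  qed (rule d)
qed

text \<open>Different entries of \<open>p\<close> have disjoint interiors, so they can share an
  interval only if it is degenerate. There \<open>g\<close> vanishes, and forgetting the tags loses
  nothing. This links the tagged divisions supplied by a gauge to the untagged families in the
  definition of absolute continuity.\<close>

lemma sum_tagged_partial_division_real:
  fixes g :: "real \<Rightarrow> real \<Rightarrow> real"
  assumes p: "p tagged_partial_division_of S" and g: "\<And>x. g x x = 0"
  shows "(\<Sum>(x,K)\<in>p. g (Inf K) (Sup K)) = (\<Sum>K\<in>snd ` p. g (Inf K) (Sup K))"
proof -
  \<comment> \<open>The explicit 0 covers \<open>cbox u v\<close> with \<open>v < u\<close>, which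
    is empty, so that its \<open>Inf\<close> and \<open>Sup\<close> say nothing about
    \<open>u\<close> and \<open>v\<close>.\<close>
  let ?d = "\<lambda>K::real set. if K = {} then 0 else g (Inf K) (Sup K)"
  have ne: "K \<noteq> {}" if "(x, K) \<in> p" for x K
    using tagged_partial_division_ofD(2)[OF p that] by blast
  have "(\<Sum>(x,K)\<in>p. g (Inf K) (Sup K)) = (\<Sum>(x,K)\<in>p. ?d K)"
    using ne by (intro sum.cong) auto
  also have "\<dots> = sum ?d (snd ` p)"
  proof (rule sum.over_tagged_division_lemma[OF tagged_partial_division_of_Union_self[OF p]])
    fix u v :: real
    assume "box u v = {}"
    then show "?d (cbox u v) = 0"
      by (cases "u = v") (auto simp: g)
  qed
  also have "\<dots> = (\<Sum>K\<in>snd ` p. g (Inf K) (Sup K))"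
    using ne by (intro sum.cong) auto
  finally show ?thesis .
qed

text \<open>
  In a tagged division that is fine enough, the intervals with tag in the exceptional null set have
  small total length, so absolute continuity makes their contribution small, while on every other
  interval the derivative at the tag bounds the increment from below.
\<close>

lemma absolutely_continuous_increment_ge:
  fixes f :: "real \<Rightarrow> real"
  assumes "a \<le> b" and ac: "absolutely_continuous_fun_on {a..b} f" and N: "negligible N"
    and deriv: "\<And>x. x \<in> {a..b} - N \<Longrightarrow>
      \<exists>d\<ge>c. (f has_real_derivative d) (at x within {a..b})"
  shows "c * (b - a) \<le> f b - f a"
proof -
  \<comment> \<open>The error collects a slope loss of \<open>e\<close> along the whole length
    \<open>b - a\<close> and at most \<open>2 * e\<close> from the intervals tagged in
    \<open>N\<close>.\<close>
  have main: "c * (b - a) \<le> f b - f a + e * (b - a + 2)" if e: "e > 0" for e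
  proof -
    obtain \<delta> where \<delta>: "\<delta> > 0" and small:
      "\<And>\<D>. \<lbrakk>\<D> division_of \<Union>\<D>; \<Union>\<D> \<subseteq> {a..b}; (\<Sum>I\<in>\<D>. Sup I - Inf I) < \<delta>\<rbrakk>
        \<Longrightarrow> (\<Sum>I\<in>\<D>. \<bar>f (Sup I) - f (Inf I)\<bar>) < e"
      using absolutely_continuous_fun_onE[OF ac e] by blast
    \<comment> \<open>The bound \<open>\<delta>\<close> serves absolute continuity. The other one
      keeps \<open>\<bar>c\<bar>\<close> times the exceptional length below \<open>e\<close>, with
      \<open>+ 1\<close> making the denominator positive when \<open>c = 0\<close>.\<close>
    define \<eta> where "\<eta> = min \<delta> (e / (\<bar>c\<bar> + 1))"
    have \<eta>: "\<eta> > 0" "\<eta> \<le> \<delta>" "\<bar>c\<bar> * \<eta> \<le> e"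
    proof -
      show "\<eta> > 0" "\<eta> \<le> \<delta>" using \<delta> e by (auto simp: \<eta>_def)
      have "\<bar>c\<bar> * \<eta> \<le> (\<bar>c\<bar> + 1) * \<eta>" using \<open>\<eta> > 0\<close> by (simp add: algebra_simps)
      also have "\<dots> \<le> (\<bar>c\<bar> + 1) * (e / (\<bar>c\<bar> + 1))"
        by (intro mult_left_mono) (auto simp: \<eta>_def)
      also have "\<dots> = e" by simp
      finally show "\<bar>c\<bar> * \<eta> \<le> e" .
    qed
    have Nnull: "N \<in> null_sets lebesgue"
      using N negligible_iff_null_sets by blast
    then obtain U where U: "open U" "N \<subseteq> U" "U - N \<in> lmeasurable"
        "emeasure lebesgue (U - N) < ennreal \<eta>"
      using sets_lebesgue_outer_open[of N \<eta>] \<eta>(1) by blast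
    have U': "U \<in> lmeasurable" "measure lebesgue U < \<eta>"
    proof -
      have Ueq: "U = (U - N) \<union> N" using U by auto
      have "emeasure lebesgue U = emeasure lebesgue (U - N)"
        using Nnull U by (metis Ueq emeasure_Un_null_set fmeasurableD)
      then have lt: "emeasure lebesgue U < ennreal \<eta>" using U by simp
      show "U \<in> lmeasurable"
        using lt \<open>open U\<close> by (intro fmeasurableI) (auto intro: less_trans)
      then show "measure lebesgue U < \<eta>"
        using lt \<eta>(1) by (simp add: emeasure_eq_measure2 ennreal_less_iff)
    qed
    \<comment> \<open>These radii form the gauge. Around a point of \<open>N\<close> the ball stays
      in the small open set \<open>U\<close>; at any other point of \<open>{a..b}\<close>, intervals
      straddling the tag have average slope at least \<open>c - e\<close>.\<close>
    have "\<exists>r>0. (x \<in> N \<longrightarrow> ball x r \<subseteq> U) \<and> (x \<in> {a..b} - N \<longrightarrow>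
        (\<forall>u v. u \<in> {a..b} \<and> v \<in> {a..b} \<and> u \<in> ball x r \<and> v \<in> ball x r \<and> u \<le> x \<and> x \<le> v
           \<longrightarrow> (c - e) * (v - u) \<le> f v - f u))" for x
    proof (cases "x \<in> {a..b} - N")
      case False
      then show ?thesis
        using U(1,2) open_contains_ball by (metis subsetD zero_less_one)
    next
      case True
      then obtain d where d: "d \<ge> c" "(f has_real_derivative d) (at x within {a..b})"
        using deriv by blast
      then obtain r where r: "r > 0" and lin:
        "\<And>y. y \<in> {a..b} \<Longrightarrow> norm (y - x) < r \<Longrightarrow>
            norm (f y - f x - d * (y - x)) \<le> e * norm (y - x)"
        using e unfolding has_field_derivative_def has_derivative_within_alt by blast
      have "(c - e) * (v - u) \<le> f v - f u"
        if uv: "u \<in> {a..b}" "v \<in> {a..b}" "u \<in> ball x r" "v \<in> ball x r" "u \<le> x" "x \<le> v"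
        for u v
      proof -
        \<comment> \<open>The linear approximation at \<open>x\<close> is applied to each half of
          the interval. As \<open>x\<close> lies between \<open>u\<close> and \<open>v\<close>, the
          two errors add up to exactly \<open>e * (v - u)\<close>.\<close>
        have "d * (v - x) - e * (v - x) \<le> f v - f x"
          using lin[of v] uv by (auto simp: dist_real_def)
        moreover have "d * (x - u) - e * (x - u) \<le> f x - f u"
          using lin[of u] uv by (auto simp: dist_real_def algebra_simps)
        moreover have "(d - c) * (v - u) \<ge> 0"
          using d uv by simp
        ultimately show ?thesis by (simp add: algebra_simps)
      qed
      with r True show ?thesis by (intro exI[of _ r]) auto
    qed
    then obtain r where r: "\<And>x. r x > 0" and rN: "\<And>x. x \<in> N \<Longrightarrow> ball x (r x) \<subseteq> U" and
      rD: "\<And>x u v. \<lbrakk>x \<in> {a..b} - N; u \<in> {a..b}; v \<in> {a..b}; u \<in> ball x (r x);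
        v \<in> ball x (r x); u \<le> x; x \<le> v\<rbrakk> \<Longrightarrow> (c - e) * (v - u) \<le> f v - f u"
      by metis
    obtain p where p: "p tagged_division_of {a..b}" and fine: "(\<lambda>x. ball x (r x)) fine p"
      using fine_division_exists_real[of "\<lambda>x. ball x (r x)" a b] gauge_ball_dependent r by blast
    note pD = tagged_division_ofD[OF p]
    define q where "q = {(x, K) \<in> p. x \<in> N}"
    have q: "q tagged_partial_division_of {a..b}"
      using p tagged_partial_division_subset tagged_division_of_def q_def
      by (metis (no_types, lifting) case_prodD mem_Collect_eq subrelI)
    have div: "snd ` q division_of \<Union>(snd ` q)"
      by (rule partial_division_of_tagged_division[OF q])
    \<comment> \<open>The lengths add up to the measure of the union, which fineness places inside
      \<open>U\<close>.\<close>
    have "(\<Sum>I\<in>snd ` q. Sup I - Inf I) = (\<Sum>I\<in>snd ` q. measure lebesgue I)"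
    proof (rule sum.cong)
      fix I assume "I \<in> snd ` q"
      then obtain u v where "I = cbox u v" "I \<noteq> {}"
        using div by (metis division_ofD(3,4))
      then show "Sup I - Inf I = measure lebesgue I" by auto
    qed simp
    also have "\<dots> = measure lebesgue (\<Union>(snd ` q))"
      by (rule content_division[OF div])
    also have "\<dots> \<le> measure lebesgue U"
    proof (rule measure_mono_fmeasurable)
      show "\<Union>(snd ` q) \<subseteq> U"
        using fine rN by (fastforce simp: q_def fine_def)
    qed (use U' lmeasurable_division[OF div] in auto)
    finally have len: "(\<Sum>I\<in>snd ` q. Sup I - Inf I) < \<eta>"
      using U' by simp
    have var: "(\<Sum>I\<in>snd ` q. \<bar>f (Sup I) - f (Inf I)\<bar>) < e"
    proof (rule small[OF div])
      show "\<Union>(snd ` q) \<subseteq> {a..b}" using pD(3) by (force simp: q_def)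
    qed (use len \<eta> in simp)
    \<comment> \<open>The correction charged to an entry: with its tag in \<open>N\<close>, it pays
      for the increment of \<open>f\<close> and for the missing multiple of the length; otherwise
      nothing is charged.\<close>
    define h where "h = (\<lambda>(x::real, K). if x \<in> N
      then \<bar>f (Sup K) - f (Inf K)\<bar> + \<bar>c\<bar> * (Sup K - Inf K) else 0)"
    have "sum h p = sum h q"
      using pD(1) by (intro sum.mono_neutral_right) (auto simp: h_def q_def split: if_splits)
    also have "\<dots> = (\<Sum>(x, K)\<in>q. \<bar>f (Sup K) - f (Inf K)\<bar> + \<bar>c\<bar> * (Sup K - Inf K))"
      by (intro sum.cong) (auto simp: h_def q_def)
    also have "\<dots> = (\<Sum>K\<in>snd ` q. \<bar>f (Sup K) - f (Inf K)\<bar> + \<bar>c\<bar> * (Sup K - Inf K))"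
      using sum_tagged_partial_division_real[OF q, of "\<lambda>u v. \<bar>f v - f u\<bar> + \<bar>c\<bar> * (v - u)"]
      by simp
    also have "\<dots> = (\<Sum>K\<in>snd ` q. \<bar>f (Sup K) - f (Inf K)\<bar>)
        + \<bar>c\<bar> * (\<Sum>K\<in>snd ` q. Sup K - Inf K)"
      by (simp add: sum.distrib sum_distrib_left)
    also have "\<dots> \<le> e + \<bar>c\<bar> * \<eta>"
      using var len by (intro add_mono mult_left_mono) auto
    also have "\<dots> \<le> 2 * e" using \<eta>(3) by simp
    finally have hsum: "sum h p \<le> 2 * e" .
    have step: "(c - e) * (Sup K - Inf K) - h (x, K) \<le> f (Sup K) - f (Inf K)"
      if xK: "(x, K) \<in> p" for x K
    proof -
      obtain u v where K: "K = cbox u v" using pD(4)[OF xK] by blast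
      have x: "u \<le> x" "x \<le> v" "x \<in> {a..b}" using pD(2,3)[OF xK] K by auto
      then have IS: "Inf K = u" "Sup K = v" using K by auto
      show ?thesis
      proof (cases "x \<in> N")
        case True
        have "(c - e) * (v - u) \<le> \<bar>c\<bar> * (v - u)"
          using x e by (intro mult_right_mono) auto
        then show ?thesis using True by (simp add: h_def IS)
      next
        case False
        have "K \<subseteq> ball x (r x)" using fine xK by (auto simp: fine_def)
        then have "(c - e) * (v - u) \<le> f v - f u"
          using False x K pD(3)[OF xK] by (intro rD[of x]) (auto simp: subset_iff)
        then show ?thesis using False by (simp add: h_def IS)
      qed
    qed
    have "(c - e) * (b - a) - 2 * e \<le> (c - e) * (b - a) - sum h p"
      using hsum by simp
    \<comment> \<open>The lengths telescope to \<open>b - a\<close>, as the increments of the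
      identity function.\<close>
    also have "\<dots> = (\<Sum>(x,K)\<in>p. (c - e) * (Sup K - Inf K) - h (x, K))"
      using additive_tagged_division_1[OF \<open>a \<le> b\<close> p, of "\<lambda>x. x"]
      by (simp add: sum_subtractf sum_distrib_left[symmetric] case_prod_unfold)
    also have "\<dots> \<le> (\<Sum>(x,K)\<in>p. f (Sup K) - f (Inf K))"
      using step by (intro sum_mono) auto
    also have "\<dots> = f b - f a"
      by (rule additive_tagged_division_1[OF \<open>a \<le> b\<close> p])
    finally show ?thesis by (simp add: algebra_simps)
  qed
  show ?thesis
  proof (rule field_le_epsilon)
    fix e :: real assume "e > 0"
    then show "c * (b - a) \<le> f b - f a + e"
      using main[of "e / (b - a + 2)"] \<open>a \<le> b\<close> by simp
  qed
qed

lemma absolutely_continuous_fun_on_subset: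
  assumes "absolutely_continuous_fun_on S f" "T \<subseteq> S"
  shows "absolutely_continuous_fun_on T f"
  using assms unfolding absolutely_continuous_fun_on_def by (meson order_trans)

section \<open>Exchange of the two colours\<close>

lemma threshold_fun_complement: "threshold_fun (1 - \<sigma>) (1 - x) = 1 - threshold_fun \<sigma> x"
  by (simp add: threshold_fun_def)

lemma finite_nbrs: "finite (pverts G) \<Longrightarrow> finite (nbrs G v)"
  by (simp add: nbrs_def)

lemma deg_pos: "finite (pverts G) \<Longrightarrow> nbrs G v \<noteq> {} \<Longrightarrow> 0 < deg G v"
  by (simp add: deg_def card_gt_0_iff finite_nbrs)

text \<open>Exchanging the colours turns \<open>\<sigma>\<close> into \<open>1 - \<sigma>\<close>
  and respects the equation because \<open>threshold_fun\<close> is symmetric, including its value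
  1/2 at a tie. The red half of the theorem thereby follows from the blue half.\<close>

lemma type1_solution_complement:
  assumes fin: "finite (pverts G)" and nbr: "\<forall>v\<in>pverts G. nbrs G v \<noteq> {}"
    and sol: "type1_solution G \<sigma> B"
  shows "type1_solution G (1 - \<sigma>) (\<lambda>v t. 1 - B v t)"
  unfolding type1_solution_def
proof (intro ballI conjI)
  fix v assume v: "v \<in> pverts G"
  show "\<forall>t\<ge>0. 1 - B v t \<in> {0..1}"
    using sol v by (auto simp: type1_solution_def)
  show "\<forall>T\<ge>0. absolutely_continuous_fun_on {0..T} (\<lambda>t. 1 - B v t)"
    using sol v absolutely_continuous_fun_on_diff_const by (auto simp: type1_solution_def)
  \<comment> \<open>The average of the constant 1 is 1 only for positive degree; division by a zero
    degree would give 0.\<close>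
  have avg: "(1 / real (deg G v)) * (\<Sum>u\<in>nbrs G v. 1 - B u t)
      = 1 - (1 / real (deg G v)) * (\<Sum>u\<in>nbrs G v. B u t)" for t
  proof -
    have "(\<Sum>u\<in>nbrs G v. 1 - B u t) = real (deg G v) - (\<Sum>u\<in>nbrs G v. B u t)"
      by (simp add: sum_subtractf deg_def)
    then show ?thesis
      using deg_pos[OF fin] nbr v by (simp add: diff_divide_distrib)
  qed
  have "AE t in lebesgue_on {0..}.
      (B v has_real_derivative
        threshold_fun \<sigma> ((1 / real (deg G v)) * (\<Sum>u\<in>nbrs G v. B u t)) - B v t)
      (at t within {0..})"
    using sol v by (auto simp: type1_solution_def)
  then show "AE t in lebesgue_on {0..}.
      ((\<lambda>t. 1 - B v t) has_real_derivative
        threshold_fun (1 - \<sigma>) ((1 / real (deg G v)) * (\<Sum>u\<in>nbrs G v. 1 - B u t))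
          - (1 - B v t))
      (at t within {0..})"
  proof eventually_elim
    case (elim t)
    have "((\<lambda>t. 1 - B v t) has_real_derivative
        0 - (threshold_fun \<sigma> ((1 / real (deg G v)) * (\<Sum>u\<in>nbrs G v. B u t)) - B v t))
      (at t within {0..})"
      by (intro DERIV_diff DERIV_const elim)
    then show ?case
      unfolding avg threshold_fun_complement by (simp add: algebra_simps)
  qed
qed

section \<open>Dynamics inside one cluster\<close>

lemma min_node_expansion_le:
  assumes "v \<in> C"
  shows "min_node_expansion G C \<le> real (card (nbrs G v \<inter> C)) / real (deg G v)"
  unfolding min_node_expansion_def
  by (rule cINF_lower[OF bdd_belowI2[of _ 0] assms]) simp

text \<open>Discarding the neighbours outside the cluster only lowers the sum, as the weights are
  nonnegative. Those that remain are at least the fraction \<open>min_node_expansion G C\<close> of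
  all neighbours.\<close>

lemma neighbour_average_ge:
  fixes w :: "'a \<Rightarrow> real"
  assumes fin: "finite (pverts G)" and v: "v \<in> C"
    and nonneg: "\<And>u. u \<in> nbrs G v \<Longrightarrow> 0 \<le> w u"
    and w: "\<And>u. u \<in> C \<Longrightarrow> \<gamma> \<le> w u" and "0 \<le> \<gamma>"
  shows "\<gamma> * min_node_expansion G C \<le> (1 / real (deg G v)) * (\<Sum>u\<in>nbrs G v. w u)"
proof -
  have "\<gamma> * min_node_expansion G C \<le> \<gamma> * (real (card (nbrs G v \<inter> C)) / real (deg G v))"
    by (intro mult_left_mono min_node_expansion_le v \<open>0 \<le> \<gamma>\<close>)
  also have "\<dots> = (1 / real (deg G v)) * (\<Sum>u\<in>nbrs G v \<inter> C. \<gamma>)"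
    by simp
  also have "\<dots> \<le> (1 / real (deg G v)) * (\<Sum>u\<in>nbrs G v \<inter> C. w u)"
    using w by (intro mult_left_mono sum_mono) auto
  also have "\<dots> \<le> (1 / real (deg G v)) * (\<Sum>u\<in>nbrs G v. w u)"
    using nonneg finite_nbrs[OF fin] by (intro mult_left_mono sum_mono2) auto
  finally show ?thesis .
qed

text \<open>While the cluster stays above \<open>\<gamma>\<close>, the neighbour average of
  \<open>v\<close> exceeds \<open>\<sigma>\<close>, so almost everywhere the derivative of
  \<open>B v\<close> is \<open>1 - B v t\<close>, which is at least \<open>c\<close>. Taking
  \<open>c = 0\<close> gives monotonicity, a positive \<open>c\<close> gives growth. The bounds stop
  short of \<open>T\<close> so that \<open>T\<close> may be a first exit time.\<close>

lemma type1_solution_increment_ge: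
  assumes fin: "finite (pverts G)" and sol: "type1_solution G \<sigma> B"
    and C: "C \<subseteq> pverts G" and v: "v \<in> C" and st: "0 \<le> s" "s \<le> T"
    and \<gamma>: "0 \<le> \<gamma>" "\<sigma> < \<gamma> * min_node_expansion G C"
    and above: "\<And>u t. \<lbrakk>u \<in> C; s \<le> t; t < T\<rbrakk> \<Longrightarrow> \<gamma> \<le> B u t"
    and below: "\<And>t. \<lbrakk>s \<le> t; t < T\<rbrakk> \<Longrightarrow> B v t \<le> 1 - c"
  shows "c * (T - s) \<le> B v T - B v s"
proof -
  let ?D = "\<lambda>t. threshold_fun \<sigma> ((1 / real (deg G v)) * (\<Sum>u\<in>nbrs G v. B u t)) - B v t"
  have vG: "v \<in> pverts G" using C v by auto
  have "AE t in lebesgue_on {0..}. (B v has_real_derivative ?D t) (at t within {0..})"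
    using sol vG by (auto simp: type1_solution_def)
  then have "AE t in lebesgue. t \<in> {0..} \<longrightarrow> (B v has_real_derivative ?D t) (at t within {0..})"
    by (subst (asm) AE_restrict_space_iff) auto
  then obtain N where N: "N \<in> null_sets lebesgue"
    and deriv: "\<And>t. t \<notin> N \<Longrightarrow> 0 \<le> t \<Longrightarrow> (B v has_real_derivative ?D t) (at t within {0..})"
    by (auto elim!: AE_E3)
  show ?thesis
  \<comment> \<open>Nothing is assumed at the endpoint \<open>T\<close>, so it joins the exceptional
    null set.\<close>
  proof (rule absolutely_continuous_increment_ge[OF \<open>s \<le> T\<close>, where N = "insert T N"])
    show "absolutely_continuous_fun_on {s..T} (B v)"
      using sol vG st absolutely_continuous_fun_on_subset[of "{0..T}" "B v" "{s..T}"]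
      by (auto simp: type1_solution_def)
    show "negligible (insert T N)"
      using N by (simp add: negligible_iff_null_sets[symmetric])
    fix t assume t: "t \<in> {s..T} - insert T N"
    have "\<gamma> * min_node_expansion G C \<le> (1 / real (deg G v)) * (\<Sum>u\<in>nbrs G v. B u t)"
      using sol t st \<gamma> above
      by (intro neighbour_average_ge fin v) (auto simp: type1_solution_def nbrs_def)
    then have "?D t = 1 - B v t"
      using \<gamma> by (simp add: threshold_fun_def)
    moreover have "(B v has_real_derivative ?D t) (at t within {s..T})"
      using deriv[of t] t st by (auto intro: DERIV_subset)
    moreover have "B v t \<le> 1 - c"
      using below t by auto
    ultimately show "\<exists>d\<ge>c. (B v has_real_derivative d) (at t within {s..T})"
      by (metis diff_le_eq le_diff_eq add.commute)
  qed
qed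

text \<open>
  Up to the infimum \<open>T\<close> of the times at which some node of the cluster is below \<open>\<gamma>\<close>, all nodes of the
  cluster are nondecreasing. So at \<open>T\<close> they are strictly above \<open>\<gamma>\<close>, and by continuity shortly after.
\<close>

lemma type1_solution_stays_above:
  assumes fin: "finite (pverts G)" and sol: "type1_solution G \<sigma> B" and C: "C \<subseteq> pverts G"
    and \<gamma>: "0 \<le> \<gamma>" "\<sigma> < \<gamma> * min_node_expansion G C"
    and init: "\<And>v. v \<in> C \<Longrightarrow> \<gamma> < B v 0"
    and "v \<in> C" "0 \<le> t"
  shows "\<gamma> \<le> B v t"
proof (rule ccontr)
  define S where "S = {t. 0 \<le> t \<and> (\<exists>u\<in>C. B u t < \<gamma>)}"
  define T where "T = Inf S"
  assume "\<not> \<gamma> \<le> B v t"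
  then have "t \<in> S" using \<open>v \<in> C\<close> \<open>0 \<le> t\<close> by (force simp: S_def)
  have bdd: "bdd_below S" by (auto simp: S_def bdd_below_def)
  have "0 \<le> T" unfolding T_def using \<open>t \<in> S\<close> by (intro cInf_greatest) (auto simp: S_def)
  have before: "\<gamma> \<le> B u x" if "u \<in> C" "0 \<le> x" "x < T" for u x
    using cInf_lower[OF _ bdd, of x] that by (force simp: S_def T_def)
  have at_T: "\<gamma> < B u T" if u: "u \<in> C" for u
  proof -
    have "0 * (T - 0) \<le> B u T - B u 0"
    proof (rule type1_solution_increment_ge[OF fin sol C u _ \<open>0 \<le> T\<close> \<gamma>])
      show "B u x \<le> 1 - 0" if "0 \<le> x" for x
        using sol C u that by (auto simp: type1_solution_def)
    qed (use before in auto)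
    then show ?thesis using init[OF u] by simp
  qed
  have "eventually (\<lambda>x. \<gamma> < B u x) (at T within {0..T + 1})" if u: "u \<in> C" for u
  proof -
    have "continuous_on {0..T + 1} (B u)"
      using sol C u \<open>0 \<le> T\<close>
      by (intro absolutely_continuous_fun_on_imp_continuous_on) (auto simp: type1_solution_def)
    then have "(B u \<longlongrightarrow> B u T) (at T within {0..T + 1})"
      using \<open>0 \<le> T\<close> by (auto simp: continuous_on)
    then show ?thesis using at_T[OF u] by (rule order_tendstoD)
  qed
  \<comment> \<open>Finiteness of the cluster lets one neighbourhood of \<open>T\<close> serve all
    its nodes.\<close>
  then have "eventually (\<lambda>x. \<forall>u\<in>C. \<gamma> < B u x) (at T within {0..T + 1})"
    using finite_subset[OF C fin] by (simp add: eventually_ball_finite_distrib)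
  then obtain r where r: "r > 0"
    and near: "\<And>x u. \<lbrakk>x \<in> {0..T + 1}; x \<noteq> T; dist x T < r; u \<in> C\<rbrakk> \<Longrightarrow> \<gamma> < B u x"
    unfolding eventually_at by blast
  \<comment> \<open>The cap 1 keeps \<open>x\<close> inside \<open>{0..T + 1}\<close>, where the
    neighbourhood was taken.\<close>
  have "T + min r 1 \<le> x" if x: "x \<in> S" for x
  proof (rule ccontr)
    assume "\<not> T + min r 1 \<le> x"
    moreover have "T \<le> x" unfolding T_def by (rule cInf_lower[OF x bdd])
    ultimately have "\<gamma> < B u x" if "u \<in> C" for u
      using near[of x u] at_T[of u] that \<open>0 \<le> T\<close> by (cases "x = T") (auto simp: dist_real_def)
    then show False using x by (force simp: S_def)
  qed
  then have "T + min r 1 \<le> T"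
    using \<open>t \<in> S\<close> unfolding T_def[symmetric] by (subst (2) T_def) (intro cInf_greatest, auto)
  then show False using r by simp
qed

text \<open>With the cluster held above a suitable level, \<open>B v\<close> is nondecreasing. If it
  were below \<open>1 - e\<close> at time \<open>T\<close>, it would have been so at all earlier
  times and hence have gained at least \<open>e * T\<close>; for \<open>T > 1 / e\<close> this
  exceeds the length of the range \<open>[0, 1]\<close>.\<close>

lemma type1_solution_cluster_tendsto_1:
  assumes fin: "finite (pverts G)" and sol: "type1_solution G \<sigma> B" and C: "C \<subseteq> pverts G"
    and "0 \<le> \<sigma>" "0 \<le> \<alpha>" and init: "\<And>v. v \<in> C \<Longrightarrow> B v 0 = \<alpha>"
    and gt: "\<sigma> < \<alpha> * min_node_expansion G C" and v: "v \<in> C"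
  shows "(B v \<longlongrightarrow> 1) at_top"
proof -
  let ?\<beta> = "min_node_expansion G C"
  have "0 < \<alpha> * ?\<beta>" using gt \<open>0 \<le> \<sigma>\<close> by simp
  then have \<beta>: "0 < ?\<beta>" using \<open>0 \<le> \<alpha>\<close> by (simp add: zero_less_mult_iff)
  then have "\<sigma> / ?\<beta> < \<alpha>" using gt by (simp add: divide_less_eq)
  \<comment> \<open>Both gaps must be strict: the initial values have to exceed
    \<open>\<gamma>\<close>, and \<open>\<gamma> * ?\<beta>\<close> has to exceed
    \<open>\<sigma>\<close>.\<close>
  then obtain \<gamma> where \<gamma>: "\<sigma> / ?\<beta> < \<gamma>" "\<gamma> < \<alpha>" using dense by blast
  have "0 \<le> \<sigma> / ?\<beta>" using \<beta> \<open>0 \<le> \<sigma>\<close> by simp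
  then have \<gamma>': "0 \<le> \<gamma>" "\<sigma> < \<gamma> * ?\<beta>"
    using \<gamma>(1) \<beta> by (linarith, simp add: divide_less_eq)
  have above: "\<gamma> \<le> B u t" if "u \<in> C" "0 \<le> t" for u t
    using type1_solution_stays_above[OF fin sol C \<gamma>'] init \<gamma> that by simp
  have range: "0 \<le> B v t" "B v t \<le> 1" if "0 \<le> t" for t
    using sol C v that by (auto simp: type1_solution_def)
  have incr: "c * (T - s) \<le> B v T - B v s"
    if "0 \<le> s" "s \<le> T" "\<And>t. \<lbrakk>s \<le> t; t < T\<rbrakk> \<Longrightarrow> B v t \<le> 1 - c" for s T c
    using that above by (intro type1_solution_increment_ge[OF fin sol C v _ _ \<gamma>']) auto
  have mono: "B v s \<le> B v T" if "0 \<le> s" "s \<le> T" for s T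
    using incr[of s T 0] range that by simp
  have lower: "1 - e \<le> B v T" if "e > 0" "1 / e < T" for e T
  proof (rule ccontr)
    assume less: "\<not> 1 - e \<le> B v T"
    have "0 < T" using that by (metis less_trans zero_less_divide_1_iff)
    have "e * (T - 0) \<le> B v T - B v 0"
    proof (rule incr)
      fix t assume "0 \<le> t" "t < T"
      then show "B v t \<le> 1 - e" using mono[of t T] less by simp
    qed (use \<open>0 < T\<close> in auto)
    moreover have "1 < e * T" using that by (simp add: divide_less_eq mult.commute)
    ultimately show False using range(2)[of T] range(1)[of 0] \<open>0 < T\<close> by simp
  qed
  show ?thesis
  proof (rule order_tendstoI)
    fix a :: real assume "a < 1"
    \<comment> \<open>Half the gap \<open>1 - a\<close> is used as \<open>e\<close>, because
      \<open>lower\<close> gives only a weak inequality.\<close>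
    then have "eventually (\<lambda>t. 1 / ((1 - a) / 2) < t) at_top" by (intro eventually_gt_at_top)
    then show "eventually (\<lambda>t. a < B v t) at_top"
    proof eventually_elim
      case (elim t)
      then have "1 - (1 - a) / 2 \<le> B v t" using \<open>a < 1\<close> by (intro lower) auto
      then show ?case using \<open>a < 1\<close> by (simp add: field_simps)
    qed
  next
    fix a :: real assume a: "1 < a"
    have "B v t < a" if "0 \<le> t" for t
      using range(2)[OF that] a by simp
    then show "eventually (\<lambda>t. B v t < a) at_top"
      unfolding eventually_at_top_linorder by blast
  qed
qed

theorem theorem2:
  fixes G :: "'a pair_pre_digraph"
    and K :: nat and C :: "nat \<Rightarrow> 'a set"
    and \<sigma> :: real and \<alpha> \<beta> :: "nat \<Rightarrow> real"
    and B :: "'a \<Rightarrow> real \<Rightarrow> real"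
  assumes graph: "pair_digraph G"
    and has_nbr: "\<forall>v\<in>pverts G. nbrs G v \<noteq> {}"
    and clusters_cover: "pverts G = (\<Union>k\<in>{1..K}. C k)"
    and clusters_nonempty: "\<forall>k\<in>{1..K}. C k \<noteq> {}"
    and clusters_disjoint: "\<forall>i\<in>{1..K}. \<forall>j\<in>{1..K}. i \<noteq> j \<longrightarrow> C i \<inter> C j = {}"
    and threshold: "0 < \<sigma>" "\<sigma> < 1"
    and solution: "type1_solution G \<sigma> B"
    and alpha_range: "\<forall>k\<in>{1..K}. \<alpha> k \<in> {0..1}"
    and initial: "\<forall>k\<in>{1..K}. \<forall>v\<in>C k. B v 0 = \<alpha> k"
    and beta: "\<forall>k\<in>{1..K}. \<beta> k = min_node_expansion G (C k)"
  shows "\<forall>k\<in>{1..K}.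
    (\<alpha> k * \<beta> k > \<sigma> \<longrightarrow> (\<forall>v\<in>C k. (B v \<longlongrightarrow> 1) at_top)) \<and>
    ((1 - \<alpha> k) * \<beta> k > 1 - \<sigma> \<longrightarrow> (\<forall>v\<in>C k. (B v \<longlongrightarrow> 0) at_top))"
proof (intro ballI impI conjI)
  have fin: "finite (pverts G)"
    using graph pair_fin_digraph.pair_finite_verts pair_digraph.axioms(1) by blast
  fix k v assume k: "k \<in> {1..K}" and v: "v \<in> C k"
  have C: "C k \<subseteq> pverts G" using clusters_cover k by blast
  show "(B v \<longlongrightarrow> 1) at_top" if "\<alpha> k * \<beta> k > \<sigma>"
    using type1_solution_cluster_tendsto_1[OF fin solution C, of "\<alpha> k"]
      that threshold alpha_range initial beta k v by auto
  show "(B v \<longlongrightarrow> 0) at_top" if "(1 - \<alpha> k) * \<beta> k > 1 - \<sigma>"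
  proof -
    \<comment> \<open>The blue case is applied to the exchanged colours, with initial value
      \<open>1 - \<alpha> k\<close> and threshold \<open>1 - \<sigma>\<close>.\<close>
    have "((\<lambda>t. 1 - B v t) \<longlongrightarrow> 1) at_top"
      using type1_solution_cluster_tendsto_1[
          OF fin type1_solution_complement[OF fin has_nbr solution] C, of "1 - \<alpha> k"]
        that threshold alpha_range initial beta k v by auto
    from tendsto_diff[OF tendsto_const[of 1] this] show ?thesis by simp
  qed
qed

end
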